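(* Let $G:\mathbb{R}_+^N\to\mathbb{R}_+^N$ be a mapping such that $G=F_{\|\cdot\|}$ for some pair $(F,\|\cdot\|)$ satisfying the compatibility assumption (see context), and suppose that $\varrho_G\circ\mathfrak{E}:\mathbb{R}_+^N\to\mathbb{R}_+$ is convex on $\mathbb{R}_{++}^N$. Let $w\in\mathbb{R}_{++}^N$, $b>0$, $r_1\in\mathbb{R}_{++}^N$, and let $(\mu_k)_{k\in\mathbb{N}}\subset\mathbb{R}_{++}$ satisfy $\lim_{k\to\infty}\mu_k=0$ and $\sum_{k\in\mathbb{N}}\mu_k=\infty$. Let $(r_k)_{k\in\mathbb{N}}$ be any sequence in $\mathbb{R}^N$ generated from $r_1$ by the following iteration: for $k=1,2,\ldots$, choose any $g_k\in\partial h_{G,\mathfrak{E}}(r_k)$ and set $$\hat r_k:=\begin{cases} r_k-\dfrac{h_{G,\mathfrak{E}}(r_k)-1}{\|g_k\|_2^2}\,g_k, & \text{if } h_{G,\mathfrak{E}}(r_k)>1,\\ r_k, & \text{if } h_{G,\mathfrak{E}}(r_k)\le 1,\end{cases}\qquad \tilde r_k:=P_{[0,b]^N}(\hat r_k),\qquad r_{k+1}:=\tilde r_k-\mu_k\nabla\Psi(\tilde r_k).$$ Then: (i) With $\Omega:=\operatorname{argmin}_{r\in[0,b]^N\cap \mathrm{lev}_{\le 1}(h_{G,\mathfrak{E}})}\Psi(r)$, we have $\lim_{k\to\infty}d_2(r_k,\Omega)=0$. (ii) $r_k\in\mathbb{R}_{++}^N$ for every $k\in\mathbb{N}$. (iii)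 $\lim_{k\to\infty}d_2(r_k,\mathcal{R})=0$. (iv) If $b$ is large enough (i.e., there is a constant $c>0$ depending only on the problem data $G$ and $w$ such that this holds whenever $b\ge c$), then $\lim_{k\to\infty}w^{\mathsf T}r_k=\max_{r\in\mathcal{R}}w^{\mathsf T}r$.
   Context: Notation. $\mathbb{N}=\{1,2,\ldots\}$, $N\in\mathbb{N}$, $\mathcal{N}=\{1,\ldots,N\}$, $\mathbb{R}_+=[0,\infty)$, $\mathbb{R}_{++}=(0,\infty)$. Vector inequalities are coordinatewise. $\|\cdot\|_2$ is the Euclidean norm, $P_C$ is the Euclidean projection onto a nonempty closed convex set $C\subset\mathbb{R}^N$, and $d_2(x,C)=\min_{y\in C}\|x-y\|_2$ (for a nonempty set $C$ for which the minimum exists). For $h:\mathbb{R}^N\to\mathbb{R}$, $\mathrm{lev}_{\le 1}(h):=\{x\in\mathbb{R}^N: h(x)\le 1\}$, and, for $h$ convex, $\partial h(x):=\{u\in\mathbb{R}^N:\langle y-x,u\rangle+h(x)\le h(y)\ \forall y\in\mathbb{R}^N\}$. A norm $\|\cdot\|$ on $\mathbb{R}^N$ is order-preserving if $0\le x\le y$ implies $\|x\|\le\|y\|$. A function $f:\mathbb{R}_+^N\to\mathbb{R}_+$ is order-preserving if $x\le y\Rightarrow f(x)\le f(y)$, and positively homogeneous if $f(\alpha x)=\alpha f(x)$ for all $\alpha>0$ and $x\in\mathbb{R}_+^N$. A function $\mathbb{R}_+^N\to\mathbb{R}_+$ is PHOC if it is positively homogeneous, order-preserving and continuous; a mapping $\mathbb{R}_+^N\to\mathbb{R}_+^N$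 is PHOC if each coordinate function is PHOC. Compatibility assumption on $(F,\|\cdot\|)$: $F=(f_n)_{n\in\mathcal{N}}:\mathbb{R}_+^N\to\mathbb{R}_{++}^N$ is continuous, $\|\cdot\|$ is an order-preserving norm on $\mathbb{R}^N$, and for each $n\in\mathcal{N}$ there exist a nonempty set $\mathcal{Y}_n$, positive scalars $(u_{n,y})_{y\in\mathcal{Y}_n}$ bounded away from zero, and PHOC functions $(g_{n,y})_{y\in\mathcal{Y}_n}$ such that $f_n(x)=\inf_{y\in\mathcal{Y}_n}(g_{n,y}(x)+u_{n,y})$ for all $x\in\mathbb{R}_+^N$, and such that the function $(f_n)_{\|\cdot\|}(x):=\inf_{y\in\mathcal{Y}_n}(g_{n,y}(x)+u_{n,y}\|x\|)$ is continuous on $\mathbb{R}_+^N$. Then $F_{\|\cdot\|}:\mathbb{R}_+^N\to\mathbb{R}_+^N$, $x\mapsto((f_n)_{\|\cdot\|}(x))_{n\in\mathcal{N}}$, which is a PHOC mapping. Spectral radius. For a PHOC mapping $T:\mathbb{R}_+^N\to\mathbb{R}_+^N$, $\rho(T):=\sup\{\lambda\in\mathbb{R}_+:\exists x\in\mathbb{R}_+^N\setminus\{0\},\ T(x)=\lambda x\}$. For a PHOC mapping $G$, $\varrho_G:\mathbb{R}_+^N\to\mathbb{R}_+$ is $\varrho_G(x):=\rho(T_{G,x})$, where $T_{G,x}(p):=\mathrm{diag}(x)G(p)$ for $p\in\mathbb{R}_+^N$. Further objects. $\mathfrak{E}:\mathbb{R}_+^N\to\mathbb{R}_+^N$, $\mathfrak{E}(r):=(e^{r_n}-1)_{n\in\mathcal{N}}$.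 $\mathcal{R}:=\{r\in\mathbb{R}_+^N:(\varrho_G\circ\mathfrak{E})(r)\le 1\}$. $h_{G,\mathfrak{E}}:\mathbb{R}^N\to\mathbb{R}_+$, $h_{G,\mathfrak{E}}(r):=(\varrho_G\circ\mathfrak{E}\circ P_{\mathbb{R}_+^N})(r)$; under the hypotheses of the claim it is convex on $\mathbb{R}^N$. $\Psi:\mathbb{R}^N\to\mathbb{R}$, $\Psi(r):=-w^{\mathsf T}r$, so $\nabla\Psi(r)=-w$. *)

theory Defs
  imports "HOL-Analysis.Analysis"
begin

text \<open>
  The space \<open>\<real>\<^sup>N\<close> is \<open>real ^ 'n\<close> with \<open>N = CARD('n)\<close>; the library order on this type is the
  coordinatewise one.  A mapping with domain \<open>\<real>\<^sub>+\<^sup>N\<close> is a total function of which only the values on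
  \<open>nonneg_orthant\<close> are constrained or used.
\<close>

definition nonneg_orthant :: "(real ^ 'n) set" where
  "nonneg_orthant = {x. 0 \<le> x}"

text \<open>Strict positivity has to be written out: the library's \<open><\<close> on vectors is \<open>\<le>\<close> together
  with \<open>\<noteq>\<close>, not strict inequality in every coordinate.\<close>

definition pos_orthant :: "(real ^ 'n) set" where
  "pos_orthant = {x. \<forall>i. 0 < x $ i}"

definition is_norm :: "(real ^ 'n \<Rightarrow> real) \<Rightarrow> bool" where
  "is_norm \<nu> \<longleftrightarrow>
     (\<forall>x. 0 \<le> \<nu> x) \<and> (\<forall>x. \<nu> x = 0 \<longleftrightarrow> x = 0) \<and>
     (\<forall>a x. \<nu> (a *\<^sub>R x) = \<bar>a\<bar> * \<nu> x) \<and> (\<forall>x y. \<nu> (x + y) \<le> \<nu> x + \<nu> y)"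

definition order_preserving_norm :: "(real ^ 'n \<Rightarrow> real) \<Rightarrow> bool" where
  "order_preserving_norm \<nu> \<longleftrightarrow> is_norm \<nu> \<and> (\<forall>x y. 0 \<le> x \<and> x \<le> y \<longrightarrow> \<nu> x \<le> \<nu> y)"

definition phoc :: "(real ^ 'n \<Rightarrow> real) \<Rightarrow> bool" where
  "phoc f \<longleftrightarrow>
     (\<forall>x \<in> nonneg_orthant. 0 \<le> f x) \<and>
     (\<forall>\<alpha> > 0. \<forall>x \<in> nonneg_orthant. f (\<alpha> *\<^sub>R x) = \<alpha> * f x) \<and>
     (\<forall>x \<in> nonneg_orthant. \<forall>y \<in> nonneg_orthant. x \<le> y \<longrightarrow> f x \<le> f y) \<and>
     continuous_on nonneg_orthant f"

text \<open>The mapping \<open>F\<^bsub>\<parallel>\<cdot>\<parallel>\<^esub>\<close>, built from the families that represent \<open>F\<close>.\<close>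

definition norm_mapping ::
  "(real ^ 'n \<Rightarrow> real) \<Rightarrow> ('n \<Rightarrow> 'y set) \<Rightarrow> ('n \<Rightarrow> 'y \<Rightarrow> real ^ 'n \<Rightarrow> real) \<Rightarrow>
     ('n \<Rightarrow> 'y \<Rightarrow> real) \<Rightarrow> real ^ 'n \<Rightarrow> real ^ 'n" where
  "norm_mapping \<nu> Y g u x = (\<chi> n. INF y \<in> Y n. g n y x + u n y * \<nu> x)"

text \<open>The compatibility assumption on \<open>(F, \<nu>)\<close>, witnessed by the families \<open>Y\<close>, \<open>g\<close>, \<open>u\<close>.  The
  infima are infima in \<open>\<real>\<close> of nonempty sets bounded below by \<open>0\<close>.\<close>

definition compatible ::
  "(real ^ 'n \<Rightarrow> real ^ 'n) \<Rightarrow> (real ^ 'n \<Rightarrow> real) \<Rightarrow> ('n \<Rightarrow> 'y set) \<Rightarrow>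
     ('n \<Rightarrow> 'y \<Rightarrow> real ^ 'n \<Rightarrow> real) \<Rightarrow> ('n \<Rightarrow> 'y \<Rightarrow> real) \<Rightarrow> bool" where
  "compatible F \<nu> Y g u \<longleftrightarrow>
     continuous_on nonneg_orthant F \<and> F ` nonneg_orthant \<subseteq> pos_orthant \<and>
     order_preserving_norm \<nu> \<and>
     (\<forall>n. Y n \<noteq> {} \<and>
          (\<exists>\<delta> > 0. \<forall>y \<in> Y n. \<delta> \<le> u n y) \<and>
          (\<forall>y \<in> Y n. phoc (g n y)) \<and>
          (\<forall>x \<in> nonneg_orthant. F x $ n = (INF y \<in> Y n. g n y x + u n y)) \<and>
          continuous_on nonneg_orthant (\<lambda>x. norm_mapping \<nu> Y g u x $ n))"

text \<open>The supremum is taken in \<open>\<real>\<close>: for a PHOC mapping the set of eigenvalues is nonempty and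
  bounded above.\<close>

definition cone_spectral_radius :: "(real ^ 'n \<Rightarrow> real ^ 'n) \<Rightarrow> real" where
  "cone_spectral_radius T = Sup {l. 0 \<le> l \<and> (\<exists>x \<in> nonneg_orthant - {0}. T x = l *\<^sub>R x)}"

definition scaled_mapping :: "(real ^ 'n \<Rightarrow> real ^ 'n) \<Rightarrow> real ^ 'n \<Rightarrow> real ^ 'n \<Rightarrow> real ^ 'n" where
  "scaled_mapping G x p = (\<chi> n. x $ n * G p $ n)"

definition spectral_fun :: "(real ^ 'n \<Rightarrow> real ^ 'n) \<Rightarrow> real ^ 'n \<Rightarrow> real" where
  "spectral_fun G x = cone_spectral_radius (scaled_mapping G x)"

definition exp_minus_one :: "real ^ 'n \<Rightarrow> real ^ 'n" where
  "exp_minus_one r = (\<chi> n. exp (r $ n) - 1)"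

definition rate_region :: "(real ^ 'n \<Rightarrow> real ^ 'n) \<Rightarrow> (real ^ 'n) set" where
  "rate_region G = {r \<in> nonneg_orthant. spectral_fun G (exp_minus_one r) \<le> 1}"

definition h_fun :: "(real ^ 'n \<Rightarrow> real ^ 'n) \<Rightarrow> real ^ 'n \<Rightarrow> real" where
  "h_fun G r = spectral_fun G (exp_minus_one (closest_point nonneg_orthant r))"

definition lev_le_one :: "(real ^ 'n \<Rightarrow> real) \<Rightarrow> (real ^ 'n) set" where
  "lev_le_one h = {x. h x \<le> 1}"

definition subdifferential :: "(real ^ 'n \<Rightarrow> real) \<Rightarrow> real ^ 'n \<Rightarrow> (real ^ 'n) set" where
  "subdifferential h x = {u. \<forall>y. (y - x) \<bullet> u + h x \<le> h y}"

definition Psi :: "real ^ 'n \<Rightarrow> real ^ 'n \<Rightarrow> real" where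
  "Psi w r = - (w \<bullet> r)"

definition gradient :: "(real ^ 'n \<Rightarrow> real) \<Rightarrow> real ^ 'n \<Rightarrow> real ^ 'n" where
  "gradient f x = (THE D. GDERIV f x :> D)"

lemma gradient_Psi: "gradient (Psi w) r = - w"
proof -
  have *: "GDERIV (Psi w) r :> - w"
    unfolding Psi_def gderiv_def inner_commute [of w] inner_minus_right
    by (intro has_derivative_minus has_derivative_inner_left has_derivative_ident)
  have "D = - w" if "GDERIV (Psi w) r :> D" for D
  proof -
    have "(\<lambda>h. h \<bullet> D) = (\<lambda>h. h \<bullet> (- w))"
      using that * unfolding gderiv_def by (rule has_derivative_unique)
    then have "\<forall>h. h \<bullet> D = h \<bullet> (- w)"
      by (blast dest: fun_cong)
    then show ?thesis
      by (rule iffD1 [OF vector_eq_ldot])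
  qed
  with * show ?thesis
    unfolding gradient_def by (rule the_equality)
qed

definition box_zero :: "real \<Rightarrow> (real ^ 'n) set" where
  "box_zero b = cbox 0 (\<chi> i. b)"

definition subgradient_step :: "(real ^ 'n \<Rightarrow> real) \<Rightarrow> real ^ 'n \<Rightarrow> real ^ 'n \<Rightarrow> real ^ 'n" where
  "subgradient_step h r s =
     (if h r > 1 then r - ((h r - 1) / (norm s)\<^sup>2) *\<^sub>R s else r)"

text \<open>Sequences are indexed from \<open>1\<close>; the values at index \<open>0\<close> play no role.\<close>

definition generated_from ::
  "(real ^ 'n \<Rightarrow> real ^ 'n) \<Rightarrow> real ^ 'n \<Rightarrow> real \<Rightarrow> (nat \<Rightarrow> real) \<Rightarrow> real ^ 'n \<Rightarrow>
     (nat \<Rightarrow> real ^ 'n) \<Rightarrow> bool" where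
  "generated_from G w b \<mu> r1 r \<longleftrightarrow>
     r 1 = r1 \<and>
     (\<exists>s. \<forall>k \<ge> 1. s k \<in> subdifferential (h_fun G) (r k) \<and>
        (let rhat = subgradient_step (h_fun G) (r k) (s k);
             rtilde = closest_point (box_zero b) rhat
         in r (Suc k) = rtilde - \<mu> k *\<^sub>R gradient (Psi w) rtilde))"

definition admissible_steps :: "(nat \<Rightarrow> real) \<Rightarrow> bool" where
  "admissible_steps \<mu> \<longleftrightarrow>
     (\<forall>k \<ge> 1. 0 < \<mu> k) \<and> \<mu> \<longlonglongrightarrow> 0 \<and> filterlim (\<lambda>m. \<Sum>k = 1..m. \<mu> k) at_top sequentially"

definition solution_set :: "(real ^ 'n \<Rightarrow> real ^ 'n) \<Rightarrow> real ^ 'n \<Rightarrow> real \<Rightarrow> (real ^ 'n) set" where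
  "solution_set G w b = {r. is_arg_min (Psi w) (\<lambda>r. r \<in> box_zero b \<inter> lev_le_one (h_fun G)) r}"

text \<open>Convergence of \<open>d\<^sub>2(r\<^sub>k, C)\<close> to \<open>0\<close>.  The library's \<open>infdist\<close> is \<open>0\<close> for the empty set and an
  infimum otherwise, so the conditions under which \<open>d\<^sub>2(\<cdot>, C)\<close> is defined as a minimum are part of
  the claim: in \<open>\<real>\<^sup>N\<close>, the minimum exists at every point iff \<open>C\<close> is nonempty and closed.\<close>

definition dist_tends_to_zero :: "(nat \<Rightarrow> real ^ 'n) \<Rightarrow> (real ^ 'n) set \<Rightarrow> bool" where
  "dist_tends_to_zero r C \<longleftrightarrow> C \<noteq> {} \<and> closed C \<and> (\<lambda>k. infdist (r k) C) \<longlonglongrightarrow> 0"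

end

theory Submission
  imports Defs
begin

text \<open>
  Two independent facts carry the proof.

  \<^bold>\<open>The function \<open>h\<close> is continuous and its level set is compact inside the orthant.\<close>  The mapping
  \<open>G\<close> is strictly positive off the origin, because the scalars \<open>u\<close> are bounded away from zero, and
  \<open>p \<le> t q\<close> implies \<open>G(p) \<le> t G(q)\<close>.  Comparing a sub-eigenvector with a super-eigenvector of \<open>p \<mapsto> diag(x) G(p)\<close>
  at the largest ratio of coordinates (\<open>sub_super_eigenvalue_le\<close>) shows that this mapping has at most
  one eigenvalue; Brouwer's theorem on the standard simplex (\<open>eigenvector_exists\<close>) gives one.  So
  \<open>\<lambda> = \<rho>(diag(x) G)\<close> means exactly that a normalised \<open>p\<close> with \<open>diag(x) G(p) = \<lambda> p\<close> exists.  This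
  is a closed condition in which \<open>p\<close> ranges over a compact set, so the graph of the spectral radius is
  closed and the spectral radius is continuous (\<open>continuous_on_spectral_fun\<close>).  The comparison with
  the unit vectors bounds the rate region (\<open>rate_region_le\<close>).

  \<^bold>\<open>The iteration is a perturbed quasi-nonexpansive iteration.\<close>  The subgradient step followed by the
  projection onto the box \<open>K\<close> decreases the squared distance to every feasible point by the squared
  lengths of the two moves, and the perturbation \<open>\<mu>\<^sub>k w\<close> changes it to first order by
  \<open>2 \<mu>\<^sub>k (w \<bullet> r\<^sub>k - w \<bullet> z)\<close> (\<open>perturbed_step_towards\<close>).  Away from the solution set \<open>\<Omega>\<close>, by
  compactness, either \<open>r\<^sub>k\<close> is infeasible by a definite amount, and the first decrease beats a
  perturbation of order \<open>\<mu>\<^sub>k\<close>, or the objective falls short of its maximum by a definite amount, and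
  the perturbation itself decreases the distance.  Both cases give a decrease of \<open>d(r\<^sub>k, \<Omega>)\<^sup>2\<close> by a
  multiple of \<open>\<mu>\<^sub>k\<close>, and \<open>\<Sum> \<mu>\<^sub>k = \<infinity>\<close> then forces \<open>d(r\<^sub>k, \<Omega>) \<rightarrow> 0\<close>
  (\<open>lyapunov_tendsto_zero\<close>, \<open>perturbed_subgradient_projection_converges\<close>).

  The claims on the rate region follow since \<open>\<Omega>\<close> is part of it, and since a box that contains
  the whole rate region makes \<open>\<Omega>\<close> the set of its maximisers.
\<close>

section \<open>The nonnegative orthant and the standard simplex\<close>

definition std_simplex :: "(real ^ 'n) set" where
  "std_simplex = {p. (\<forall>i. 0 \<le> p $ i) \<and> (\<Sum>i\<in>UNIV. p $ i) = 1}"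

lemma nonneg_orthant_iff: "x \<in> nonneg_orthant \<longleftrightarrow> (\<forall>i. 0 \<le> x $ i)"
  by (simp add: nonneg_orthant_def less_eq_vec_def)

lemma std_simplex_subset: "std_simplex \<subseteq> nonneg_orthant - {0}"
  by (auto simp: std_simplex_def nonneg_orthant_iff)

lemma closed_nonneg_orthant: "closed (nonneg_orthant :: (real ^ 'n) set)"
proof -
  have "nonneg_orthant = (\<Inter>i. {x :: real ^ 'n. 0 \<le> x $ i})"
    by (auto simp: nonneg_orthant_iff)
  also have "closed \<dots>"
    by (intro closed_INT ballI closed_Collect_le continuous_intros)
  finally show ?thesis .
qed

lemma convex_nonneg_orthant: "convex (nonneg_orthant :: (real ^ 'n) set)"
  by (auto simp: convex_def nonneg_orthant_iff)

lemma zero_in_nonneg_orthant: "0 \<in> nonneg_orthant"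
  by (simp add: nonneg_orthant_iff)

lemma compact_std_simplex: "compact (std_simplex :: (real ^ 'n) set)"
proof -
  have "p $ i \<le> 1" if "p \<in> std_simplex" for p :: "real ^ 'n" and i
    using that member_le_sum [of i UNIV "\<lambda>i. p $ i"] by (auto simp: std_simplex_def)
  then have "std_simplex \<subseteq> cbox (0 :: real ^ 'n) 1"
    by (auto simp: mem_box_cart std_simplex_def)
  then have bdd: "bounded (std_simplex :: (real ^ 'n) set)"
    using bounded_cbox bounded_subset by blast
  have eq: "std_simplex = nonneg_orthant \<inter> {p :: real ^ 'n. (\<Sum>i\<in>UNIV. p $ i) = 1}"
    by (auto simp: std_simplex_def nonneg_orthant_iff)
  have "closed (std_simplex :: (real ^ 'n) set)"
    unfolding eq by (intro closed_Int closed_nonneg_orthant closed_Collect_eq continuous_intros)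
  with bdd show ?thesis
    by (simp add: compact_eq_bounded_closed)
qed

lemma convex_std_simplex: "convex (std_simplex :: (real ^ 'n) set)"
  by (auto simp: convex_def std_simplex_def sum.distrib simp flip: sum_distrib_left)

lemma std_simplex_nonempty: "(std_simplex :: (real ^ 'n) set) \<noteq> {}"
proof -
  have "axis i 1 \<in> std_simplex" for i :: 'n
    by (auto simp: std_simplex_def axis_def)
  then show ?thesis by blast
qed

section \<open>Spectral radius of strictly positive monotone homogeneous mappings\<close>

text \<open>On the orthant, monotonicity and positive homogeneity together are equivalent to the single
  condition \<open>dominated\<close>, the form in which the comparison of eigenvectors uses them.\<close>

locale perron_mapping =
  fixes G :: "real ^ 'n \<Rightarrow> real ^ 'n"
  assumes cont: "continuous_on nonneg_orthant G"
    and positive: "\<lbrakk>p \<in> nonneg_orthant; p \<noteq> 0\<rbrakk> \<Longrightarrow> 0 < G p $ i"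
    and dominated: "\<lbrakk>p \<in> nonneg_orthant; q \<in> nonneg_orthant; 0 < t; p \<le> t *\<^sub>R q\<rbrakk>
      \<Longrightarrow> G p $ i \<le> t * G q $ i"
begin

text \<open>Let \<open>t\<close> be the largest ratio \<open>p\<^sub>i / q\<^sub>i\<close>, attained at \<open>i\<close>.  From \<open>p \<le> t q\<close> one gets
  \<open>\<alpha> p\<^sub>i \<le> x\<^sub>i G(p)\<^sub>i \<le> t x\<^sub>i G(q)\<^sub>i \<le> t \<beta> q\<^sub>i = \<beta> p\<^sub>i\<close>.  Strict positivity of \<open>G\<close> makes the ratios
  meaningful: it forces \<open>q\<close> to be positive on the support of \<open>p\<close>.\<close>

lemma sub_super_eigenvalue_le:
  assumes x: "x \<in> nonneg_orthant"
    and p: "p \<in> nonneg_orthant" "p \<noteq> 0" "\<And>i. \<alpha> * p $ i \<le> x $ i * G p $ i"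
    and q: "q \<in> nonneg_orthant" "q \<noteq> 0" "\<And>i. x $ i * G q $ i \<le> \<beta> * q $ i"
    and "0 \<le> \<beta>"
  shows "\<alpha> \<le> \<beta>"
proof (cases "0 < \<alpha>")
  case True
  define S where "S = {i. 0 < p $ i}"
  have p0: "0 \<le> p $ i" and q0: "0 \<le> q $ i" and x0: "0 \<le> x $ i" for i
    using p q x by (auto simp: nonneg_orthant_iff)
  have "S \<noteq> {}"
  proof
    assume "S = {}"
    then have "p $ i = 0" for i
      using p0 [of i] by (auto simp: S_def less_le)
    with p(2) show False by (simp add: vec_eq_iff)
  qed
  have qpos: "0 < q $ i" if "i \<in> S" for i
  proof -
    have "0 < \<alpha> * p $ i" using True that by (simp add: S_def)
    with p(3) [of i] have "0 < x $ i * G p $ i" by linarith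
    with x0 [of i] have "0 < x $ i" by (simp add: less_le)
    then have "0 < x $ i * G q $ i" using positive q by simp
    with q(3) [of i] have "0 < \<beta> * q $ i" by linarith
    with \<open>0 \<le> \<beta>\<close> show ?thesis by (simp add: zero_less_mult_iff)
  qed
  define t where "t = Max ((\<lambda>i. p $ i / q $ i) ` S)"
  have "t \<in> (\<lambda>i. p $ i / q $ i) ` S"
    unfolding t_def using \<open>S \<noteq> {}\<close> by (intro Max_in) auto
  then obtain i where i: "i \<in> S" "t = p $ i / q $ i" by blast
  have t: "0 < t" using i qpos by (simp add: S_def)
  have "p \<le> t *\<^sub>R q"
    unfolding less_eq_vec_def
  proof
    fix j
    show "p $ j \<le> (t *\<^sub>R q) $ j"
    proof (cases "j \<in> S")
      case True
      then have "p $ j / q $ j \<le> t" unfolding t_def by (intro Max_ge) auto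
      with qpos [OF True] show ?thesis by (simp add: pos_divide_le_eq)
    next
      case False
      then have "p $ j \<le> 0" by (simp add: S_def)
      also have "0 \<le> t * q $ j" using t q0 by simp
      finally show ?thesis by simp
    qed
  qed
  then have "G p $ i \<le> t * G q $ i" using dominated p q t by blast
  then have "x $ i * G p $ i \<le> x $ i * (t * G q $ i)" by (rule mult_left_mono [OF _ x0])
  also have "\<dots> = t * (x $ i * G q $ i)" by simp
  also have "\<dots> \<le> t * (\<beta> * q $ i)" using q(3) t by simp
  also have "\<dots> = \<beta> * p $ i" using i qpos [OF i(1)] by simp
  finally have "\<alpha> * p $ i \<le> \<beta> * p $ i" using p(3) [of i] by linarith
  with i show ?thesis by (simp add: S_def)
qed (use \<open>0 \<le> \<beta>\<close> in simp)

text \<open>The comparison, applied in both directions to two eigenvectors, identifies their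
  eigenvalues.  Hence the supremum defining the spectral radius is taken over a singleton.\<close>

lemma spectral_fun_eqI:
  assumes x: "x \<in> nonneg_orthant" and "0 \<le> l"
    and p: "p \<in> nonneg_orthant" "p \<noteq> 0" "scaled_mapping G x p = l *\<^sub>R p"
  shows "spectral_fun G x = l"
proof -
  have eig: "x $ i * G q $ i = m * q $ i" if "scaled_mapping G x q = m *\<^sub>R q" for q m i
    using that by (simp add: scaled_mapping_def vec_eq_iff)
  have "m = l" if m: "0 \<le> m" "q \<in> nonneg_orthant" "q \<noteq> 0" "scaled_mapping G x q = m *\<^sub>R q"
    for m q
  proof (rule antisym)
    show "m \<le> l"
      by (rule sub_super_eigenvalue_le [OF x m(2,3) _ p(1,2)])
        (use eig [OF m(4)] eig [OF p(3)] \<open>0 \<le> l\<close> in auto)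
    show "l \<le> m"
      by (rule sub_super_eigenvalue_le [OF x p(1,2) _ m(2,3)])
        (use eig [OF m(4)] eig [OF p(3)] m(1) in auto)
  qed
  then have "{m. 0 \<le> m \<and> (\<exists>q \<in> nonneg_orthant - {0}. scaled_mapping G x q = m *\<^sub>R q)} = {l}"
    using assms by blast
  then show ?thesis by (simp add: spectral_fun_def cone_spectral_radius_def)
qed

text \<open>For \<open>p\<close> in the simplex this is the only candidate for an eigenvalue with eigenvector \<open>p\<close>, as
  the sum of the coordinates in \<open>diag(x) G(p) = \<lambda> p\<close> shows.\<close>

definition scaled_sum :: "real ^ 'n \<Rightarrow> real ^ 'n \<Rightarrow> real" where
  "scaled_sum x p = (\<Sum>i\<in>UNIV. x $ i * G p $ i)"

lemma scaled_sum_nonneg: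
  assumes "x \<in> nonneg_orthant" "p \<in> std_simplex"
  shows "0 \<le> scaled_sum x p"
  unfolding scaled_sum_def
proof (intro sum_nonneg mult_nonneg_nonneg)
  fix i
  show "0 \<le> x $ i" using assms by (simp add: nonneg_orthant_iff)
  have "p \<in> nonneg_orthant" "p \<noteq> 0" using assms std_simplex_subset by auto
  then show "0 \<le> G p $ i" by (simp add: positive less_imp_le)
qed

text \<open>For \<open>x \<noteq> 0\<close> the mapping \<open>p \<mapsto> diag(x) G(p)\<close> vanishes nowhere on the simplex, so it can be
  normalised to a continuous self-map of the simplex, and a Brouwer fixed point is an eigenvector.\<close>

lemma eigenvector_exists:
  assumes x: "x \<in> nonneg_orthant"
  obtains p where "p \<in> std_simplex" "scaled_mapping G x p = scaled_sum x p *\<^sub>R p"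
proof (cases "x = 0")
  case True
  obtain p where "p \<in> (std_simplex :: (real ^ 'n) set)"
    using std_simplex_nonempty by blast
  with True show ?thesis
    by (intro that [of p]) (simp_all add: scaled_mapping_def scaled_sum_def vec_eq_iff)
next
  case False
  have x0: "0 \<le> x $ i" for i using x by (simp add: nonneg_orthant_iff)
  obtain k where "x $ k \<noteq> 0" using False by (auto simp: vec_eq_iff)
  with x0 [of k] have k: "0 < x $ k" by simp
  have pos: "0 < G p $ i" if "p \<in> std_simplex" for p i
    using that std_simplex_subset by (intro positive) auto
  have spos: "0 < scaled_sum x p" if "p \<in> std_simplex" for p
    unfolding scaled_sum_def
  proof (rule sum_pos2 [of _ k])
    show "0 < x $ k * G p $ k" using k pos [OF that] by simp
    show "0 \<le> x $ i * G p $ i" for i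
      using x0 [of i] pos [OF that, of i] by simp
  qed simp_all
  have contS: "continuous_on std_simplex G"
    by (rule continuous_on_subset [OF cont]) (use std_simplex_subset in blast)
  have "continuous_on std_simplex (\<lambda>p. (1 / scaled_sum x p) *\<^sub>R scaled_mapping G x p)"
  proof (intro continuous_intros)
    show "continuous_on std_simplex (\<lambda>p. scaled_sum x p)"
      unfolding scaled_sum_def by (intro continuous_intros contS)
    show "continuous_on std_simplex (\<lambda>p. scaled_mapping G x p)"
      unfolding scaled_mapping_def by (intro continuous_intros contS)
    show "\<forall>p \<in> std_simplex. scaled_sum x p \<noteq> 0"
      by (intro ballI less_imp_neq [THEN not_sym] spos)
  qed
  moreover have "(\<lambda>p. (1 / scaled_sum x p) *\<^sub>R scaled_mapping G x p) \<in> std_simplex \<rightarrow> std_simplex"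
  proof
    fix p :: "real ^ 'n" assume p: "p \<in> std_simplex"
    have "(\<Sum>i\<in>UNIV. x $ i * G p $ i / scaled_sum x p) = scaled_sum x p / scaled_sum x p"
      by (subst (2) scaled_sum_def) (rule sum_divide_distrib [symmetric])
    then have "(\<Sum>i\<in>UNIV. x $ i * G p $ i / scaled_sum x p) = 1"
      using spos [OF p] by simp
    moreover have "0 \<le> x $ i * G p $ i / scaled_sum x p" for i
      using spos [OF p] pos [OF p, of i] x0 [of i] by simp
    ultimately show "(1 / scaled_sum x p) *\<^sub>R scaled_mapping G x p \<in> std_simplex"
      by (simp add: std_simplex_def scaled_mapping_def)
  qed
  ultimately obtain p where p: "p \<in> std_simplex"
    and fp: "(1 / scaled_sum x p) *\<^sub>R scaled_mapping G x p = p"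
    by (rule brouwer [OF compact_std_simplex convex_std_simplex std_simplex_nonempty])
  have "scaled_mapping G x p = scaled_sum x p *\<^sub>R p"
    using arg_cong [OF fp, of "\<lambda>v. scaled_sum x p *\<^sub>R v"] spos [OF p] by simp
  with p show ?thesis by (rule that)
qed

lemma spectral_fun_eq_scaled_sum:
  assumes "x \<in> nonneg_orthant" "p \<in> std_simplex" "scaled_mapping G x p = scaled_sum x p *\<^sub>R p"
  shows "spectral_fun G x = scaled_sum x p"
  using spectral_fun_eqI scaled_sum_nonneg assms std_simplex_subset by blast

lemma spectral_fun_zero: "spectral_fun G 0 = 0"
proof -
  obtain p where "p \<in> (std_simplex :: (real ^ 'n) set)"
    using std_simplex_nonempty by blast
  then show ?thesis
    using std_simplex_subset
    by (intro spectral_fun_eqI [of _ _ p] zero_in_nonneg_orthant)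
      (auto simp: scaled_mapping_def vec_eq_iff)
qed

text \<open>The unit vector is a sub-eigenvector: its image is nonnegative and has diagonal entry
  \<open>x\<^sub>i G(e\<^sub>i)\<^sub>i\<close> at \<open>i\<close>.\<close>

lemma spectral_fun_ge_diagonal:
  assumes x: "x \<in> nonneg_orthant"
  shows "x $ i * G (axis i 1) $ i \<le> spectral_fun G x"
proof -
  obtain p where p: "p \<in> std_simplex" "scaled_mapping G x p = scaled_sum x p *\<^sub>R p"
    using eigenvector_exists [OF x] .
  have e: "axis i 1 \<in> nonneg_orthant" "axis i 1 \<noteq> (0 :: real ^ 'n)"
    by (auto simp: nonneg_orthant_iff axis_def vec_eq_iff)
  have nn: "0 \<le> x $ j * G (axis i 1) $ j" for j
    using x positive [OF e] by (simp add: nonneg_orthant_iff less_imp_le)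
  have "x $ i * G (axis i 1) $ i \<le> scaled_sum x p"
  proof (rule sub_super_eigenvalue_le [OF x e])
    show "x $ i * G (axis i 1) $ i * axis i 1 $ j \<le> x $ j * G (axis i 1) $ j" for j
      using nn [of j] by (auto simp: axis_def)
    show "p \<in> nonneg_orthant" "p \<noteq> 0" using p(1) std_simplex_subset by auto
    show "x $ j * G p $ j \<le> scaled_sum x p * p $ j" for j
      using arg_cong [OF p(2), of "\<lambda>v. v $ j"] by (simp add: scaled_mapping_def)
    show "0 \<le> scaled_sum x p" using scaled_sum_nonneg x p(1) .
  qed
  then show ?thesis using spectral_fun_eq_scaled_sum x p by simp
qed

text \<open>On a bounded part \<open>X\<close> of the orthant, the pairs of a scaling \<open>x\<close> and a normalised eigenvector
  form a compact set \<open>E\<close>.  The graph of the spectral radius is a continuous image of \<open>E\<close>, hence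
  closed, and a function with closed graph and values in a compact set is continuous.\<close>

lemma continuous_on_spectral_fun: "continuous_on nonneg_orthant (spectral_fun G)"
proof -
  \<comment> \<open>Boundedness supplies the compact codomain that the closed graph argument needs.\<close>
  have bdd: "continuous_on (nonneg_orthant \<inter> cball 0 R) (spectral_fun G)" for R
  proof -
    define X where "X = nonneg_orthant \<inter> cball (0 :: real ^ 'n) R"
    define E where "E = {z \<in> X \<times> std_simplex.
      scaled_mapping G (fst z) (snd z) - scaled_sum (fst z) (snd z) *\<^sub>R snd z = 0}"
    have XS: "compact (X \<times> (std_simplex :: (real ^ 'n) set))"
      unfolding X_def
      by (intro compact_Times compact_std_simplex closed_Int_compact closed_nonneg_orthant compact_cball)
    have G: "continuous_on (X \<times> std_simplex) (\<lambda>z. G (snd z))"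
      using std_simplex_subset by (intro continuous_on_compose2 [OF cont] continuous_intros) auto
    have s: "continuous_on (X \<times> std_simplex) (\<lambda>z. scaled_sum (fst z) (snd z))"
      unfolding scaled_sum_def by (intro continuous_intros G)
    have "continuous_on (X \<times> std_simplex)
        (\<lambda>z. scaled_mapping G (fst z) (snd z) - scaled_sum (fst z) (snd z) *\<^sub>R snd z)"
      unfolding scaled_mapping_def by (intro continuous_intros G s)
    then have "closed E"
      unfolding E_def using XS compact_imp_closed continuous_closed_preimage_constant by blast
    then have "compact ((X \<times> std_simplex) \<inter> E)"
      using XS compact_Int_closed by blast
    also have "(X \<times> std_simplex) \<inter> E = E" by (auto simp: E_def)
    finally have E: "compact E" .
    have sE: "continuous_on E (\<lambda>z. scaled_sum (fst z) (snd z))"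
      using s by (rule continuous_on_subset) (auto simp: E_def)
    have spec: "spectral_fun G (fst z) = scaled_sum (fst z) (snd z)" if "z \<in> E" for z
      using that by (intro spectral_fun_eq_scaled_sum) (auto simp: E_def X_def)
    have ex: "\<exists>z \<in> E. fst z = x" if "x \<in> X" for x
    proof -
      have "x \<in> nonneg_orthant" using that by (simp add: X_def)
      then obtain p where "p \<in> std_simplex" "scaled_mapping G x p = scaled_sum x p *\<^sub>R p"
        using eigenvector_exists by blast
      with that have "(x, p) \<in> E" by (simp add: E_def)
      then show ?thesis by force
    qed
    have "compact ((\<lambda>z. (fst z, scaled_sum (fst z) (snd z))) ` E)"
      by (intro compact_continuous_image continuous_intros sE E)
    also have "(\<lambda>z. (fst z, scaled_sum (fst z) (snd z))) ` E = (\<lambda>x. (x, spectral_fun G x)) ` X"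
    proof safe
      fix x p assume "(x, p) \<in> E"
      then have "x \<in> X" "spectral_fun G x = scaled_sum x p"
        using spec by (auto simp: E_def)
      then show "(fst (x, p), scaled_sum (fst (x, p)) (snd (x, p))) \<in> (\<lambda>x. (x, spectral_fun G x)) ` X"
        by (intro image_eqI [of _ _ x]) simp_all
    next
      fix x assume "x \<in> X"
      then obtain z where "z \<in> E" "fst z = x" using ex by blast
      then show "(x, spectral_fun G x) \<in> (\<lambda>z. (fst z, scaled_sum (fst z) (snd z))) ` E"
        using spec by force
    qed
    finally have "closed ((\<lambda>x. (x, spectral_fun G x)) ` X)" by (rule compact_imp_closed)
    moreover have "compact ((\<lambda>z. scaled_sum (fst z) (snd z)) ` E)"
      by (rule compact_continuous_image [OF sE E])
    moreover have "spectral_fun G \<in> X \<rightarrow> (\<lambda>z. scaled_sum (fst z) (snd z)) ` E"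
      using spec ex by force
    ultimately have "continuous_on X (spectral_fun G)"
      using continuous_from_closed_graph by blast
    then show ?thesis by (simp add: X_def)
  qed
  show ?thesis
    unfolding continuous_on_eq_continuous_within
  proof
    fix x :: "real ^ 'n" assume x: "x \<in> nonneg_orthant"
    define R where "R = norm x + 1"
    have "continuous (at x within nonneg_orthant \<inter> cball 0 R) (spectral_fun G)"
      using bdd [of R] x by (simp add: continuous_on_eq_continuous_within R_def)
    also have "at x within nonneg_orthant \<inter> cball 0 R = at x within nonneg_orthant"
      by (rule at_within_nhd [of x "ball 0 R"]) (auto simp: R_def)
    finally show "continuous (at x within nonneg_orthant) (spectral_fun G)" .
  qed
qed

lemma exp_minus_one_nonneg: "r \<in> nonneg_orthant \<Longrightarrow> exp_minus_one r \<in> nonneg_orthant"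
  by (simp add: nonneg_orthant_iff exp_minus_one_def)

lemma continuous_on_h_fun: "continuous_on UNIV (h_fun G)"
proof -
  have "continuous_on UNIV (\<lambda>r. exp_minus_one (closest_point nonneg_orthant r) :: real ^ 'n)"
    unfolding exp_minus_one_def
    by (intro continuous_intros continuous_on_closest_point convex_nonneg_orthant closed_nonneg_orthant)
      (use zero_in_nonneg_orthant in blast)
  then show ?thesis
    unfolding h_fun_def
  proof (rule continuous_on_compose2 [OF continuous_on_spectral_fun], intro image_subsetI)
    fix r :: "real ^ 'n"
    show "exp_minus_one (closest_point nonneg_orthant r) \<in> nonneg_orthant"
      by (intro exp_minus_one_nonneg closest_point_in_set closed_nonneg_orthant)
        (use zero_in_nonneg_orthant in blast)
  qed
qed

lemma rate_region_eq: "rate_region G = nonneg_orthant \<inter> lev_le_one (h_fun G)"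
  by (auto simp: rate_region_def lev_le_one_def h_fun_def closest_point_self)

lemma closed_lev_h_fun: "closed (lev_le_one (h_fun G))"
  unfolding lev_le_one_def
  by (intro closed_Collect_le continuous_on_h_fun continuous_intros)

lemma zero_in_lev: "0 \<in> lev_le_one (h_fun G)"
proof -
  have "exp_minus_one 0 = (0 :: real ^ 'n)" by (simp add: exp_minus_one_def vec_eq_iff)
  then show ?thesis
    by (simp add: lev_le_one_def h_fun_def closest_point_self zero_in_nonneg_orthant spectral_fun_zero)
qed

text \<open>Combine \<open>r \<le> e\<^sup>r - 1\<close> with the diagonal lower bound for the spectral radius.\<close>

lemma rate_region_le:
  assumes "r \<in> rate_region G"
  shows "r $ i \<le> 1 / G (axis i 1) $ i"
proof -
  have r: "r \<in> nonneg_orthant" "spectral_fun G (exp_minus_one r) \<le> 1"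
    using assms by (auto simp: rate_region_def)
  have pos: "0 < G (axis i 1) $ i"
    by (rule positive) (auto simp: nonneg_orthant_iff axis_def vec_eq_iff)
  have "r $ i \<le> exp_minus_one r $ i"
    using exp_ge_add_one_self [of "r $ i"] by (simp add: exp_minus_one_def algebra_simps)
  then have "r $ i * G (axis i 1) $ i \<le> exp_minus_one r $ i * G (axis i 1) $ i"
    using pos by simp
  also have "exp_minus_one r $ i * G (axis i 1) $ i \<le> 1"
    using spectral_fun_ge_diagonal [OF exp_minus_one_nonneg [OF r(1)]] r(2) by (rule order_trans)
  finally show ?thesis using pos by (simp add: pos_le_divide_eq)
qed

end

section \<open>Convergence of the perturbed subgradient projection\<close>

text \<open>As long as \<open>d\<close> stays above \<open>\<epsilon> / 2\<close>, its square loses \<open>\<eta> \<mu>\<^sub>k\<close> in each step, which a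
  divergent series does not allow forever.  Once \<open>d\<close> is below \<open>\<epsilon> / 2\<close>, a single step raises it by
  less than \<open>\<epsilon> / 2\<close>, and above \<open>\<epsilon> / 2\<close> it decreases again; so it stays below \<open>\<epsilon>\<close>.\<close>

lemma lyapunov_tendsto_zero:
  fixes d \<mu> :: "nat \<Rightarrow> real"
  assumes d: "\<And>k. 0 \<le> d k"
    and \<mu>: "\<mu> \<longlonglongrightarrow> 0" "filterlim (\<lambda>m. \<Sum>k = 1..m. \<mu> k) at_top sequentially"
      "\<And>k. 1 \<le> k \<Longrightarrow> 0 < \<mu> k"
    and small: "\<forall>\<^sub>F k in sequentially. d (Suc k) \<le> d k + c * \<mu> k"
    and large: "\<And>\<epsilon>. 0 < \<epsilon> \<Longrightarrow> \<exists>\<eta> > 0. \<forall>\<^sub>F k in sequentially.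
      \<epsilon> \<le> d k \<longrightarrow> (d (Suc k))\<^sup>2 \<le> (d k)\<^sup>2 - \<eta> * \<mu> k"
  shows "d \<longlonglongrightarrow> 0"
proof (rule LIMSEQ_I)
  fix \<epsilon> :: real assume \<epsilon>: "0 < \<epsilon>"
  then obtain \<eta> where \<eta>: "0 < \<eta>" and *: "\<forall>\<^sub>F k in sequentially.
      \<epsilon> / 2 \<le> d k \<longrightarrow> (d (Suc k))\<^sup>2 \<le> (d k)\<^sup>2 - \<eta> * \<mu> k"
    using large [of "\<epsilon> / 2"] by auto
  have "(\<lambda>k. c * \<mu> k) \<longlonglongrightarrow> 0" using tendsto_mult_right_zero [OF \<mu>(1)] .
  then have "\<forall>\<^sub>F k in sequentially. c * \<mu> k < \<epsilon> / 2"
    by (rule order_tendstoD(2)) (use \<epsilon> in simp)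
  then have "\<forall>\<^sub>F k in sequentially. 1 \<le> k \<and> c * \<mu> k < \<epsilon> / 2 \<and> d (Suc k) \<le> d k + c * \<mu> k \<and>
      (\<epsilon> / 2 \<le> d k \<longrightarrow> (d (Suc k))\<^sup>2 \<le> (d k)\<^sup>2 - \<eta> * \<mu> k)"
    using small * eventually_ge_at_top [of 1] by eventually_elim simp
  then obtain N where N: "c * \<mu> k < \<epsilon> / 2" "d (Suc k) \<le> d k + c * \<mu> k" "1 \<le> k"
      "\<epsilon> / 2 \<le> d k \<Longrightarrow> (d (Suc k))\<^sup>2 \<le> (d k)\<^sup>2 - \<eta> * \<mu> k" if "N \<le> k" for k
    by (auto simp: eventually_sequentially)
  have "\<exists>k \<ge> N. d k < \<epsilon> / 2"
  proof (rule ccontr)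
    assume "\<not> (\<exists>k \<ge> N. d k < \<epsilon> / 2)"
    then have far: "\<epsilon> / 2 \<le> d k" if "N \<le> k" for k using that by (simp add: not_less)
    have desc: "\<eta> * (\<Sum>k = 1..N + m. \<mu> k) \<le> (d N)\<^sup>2 + \<eta> * (\<Sum>k = 1..N. \<mu> k) - (d (Suc (N + m)))\<^sup>2" for m
    proof (induction m)
      case 0
      show ?case using N(4) [of N] far [of N] mult_pos_pos [OF \<eta> \<mu>(3) [OF N(3) [of N]]] by simp
    next
      case (Suc m)
      then show ?case
        using N(4) [of "Suc (N + m)"] far [of "Suc (N + m)"] by (simp add: algebra_simps)
    qed
    obtain M where M: "((d N)\<^sup>2 + \<eta> * (\<Sum>k = 1..N. \<mu> k)) / \<eta> + 1 \<le> (\<Sum>k = 1..m. \<mu> k)"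
      if "M \<le> m" for m
      using \<mu>(2) unfolding filterlim_at_top eventually_sequentially by blast
    have "((d N)\<^sup>2 + \<eta> * (\<Sum>k = 1..N. \<mu> k)) / \<eta> < (\<Sum>k = 1..N + M. \<mu> k)"
      using M [of "N + M"] by simp
    then have "(d N)\<^sup>2 + \<eta> * (\<Sum>k = 1..N. \<mu> k) < \<eta> * (\<Sum>k = 1..N + M. \<mu> k)"
      using \<eta> by (simp add: pos_divide_less_eq mult.commute)
    with desc [of M] zero_le_power2 [of "d (Suc (N + M))"] show False by linarith
  qed
  then obtain K where K: "N \<le> K" "d K < \<epsilon> / 2" by blast
  have "d k < \<epsilon>" if "K \<le> k" for k
    using that
  proof (induction k rule: dec_induct)
    case base
    then show ?case using K \<epsilon> by simp
  next
    case (step k)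
    then have k: "N \<le> k" using K by simp
    show ?case
    proof (cases "d k < \<epsilon> / 2")
      case True
      then show ?thesis using N(1,2) [OF k] by linarith
    next
      case False
      then have "(d (Suc k))\<^sup>2 \<le> (d k)\<^sup>2 - \<eta> * \<mu> k" using N(4) [OF k] by simp
      also have "\<dots> \<le> (d k)\<^sup>2" using \<eta> \<mu>(3) [OF N(3) [OF k]] by simp
      finally have "d (Suc k) \<le> d k" using d power2_le_imp_le by blast
      then show ?thesis using step by simp
    qed
  qed
  then show "\<exists>K. \<forall>k \<ge> K. norm (d k - 0) < \<epsilon>" using d by auto
qed

text \<open>If \<open>h r > 1\<close>, the step is the projection onto the half-space
  \<open>{y. (y - r) \<bullet> s + h r \<le> 1}\<close>, which contains every point of the level set.\<close>

lemma subgradient_step_towards: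
  assumes s: "s \<in> subdifferential h r" and z: "h z \<le> 1"
  shows "(norm (subgradient_step h r s - z))\<^sup>2
    \<le> (norm (r - z))\<^sup>2 - (norm (subgradient_step h r s - r))\<^sup>2"
proof (cases "1 < h r")
  case True
  define t where "t = (h r - 1) / (norm s)\<^sup>2"
  have 1: "(z - r) \<bullet> s + h r \<le> h z" using s by (simp add: subdifferential_def)
  with True z have "s \<noteq> 0" by auto
  then have ts: "t * (norm s)\<^sup>2 = h r - 1" and t: "0 < t" using True by (simp_all add: t_def)
  have step: "subgradient_step h r s = r - t *\<^sub>R s" using True by (simp add: subgradient_step_def t_def)
  have "(norm (r - t *\<^sub>R s - z))\<^sup>2 = (norm (r - z))\<^sup>2 + 2 * t * ((z - r) \<bullet> s) + t * (t * (norm s)\<^sup>2)"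
    unfolding power2_norm_eq_inner by (simp add: inner_simps inner_commute algebra_simps)
  moreover have "t * ((z - r) \<bullet> s) \<le> t * (- (t * (norm s)\<^sup>2))"
    using 1 z ts t by (intro mult_left_mono) auto
  ultimately have "(norm (r - t *\<^sub>R s - z))\<^sup>2 \<le> (norm (r - z))\<^sup>2 - t * (t * (norm s)\<^sup>2)"
    by simp
  also have "t * (t * (norm s)\<^sup>2) = (norm (t *\<^sub>R s))\<^sup>2" by (simp add: power_mult_distrib power2_eq_square)
  finally show ?thesis by (simp add: step)
qed (simp add: subgradient_step_def)

lemma closest_point_towards:
  fixes K :: "('a :: euclidean_space) set"
  assumes "convex K" "closed K" "z \<in> K"
  shows "(norm (closest_point K a - z))\<^sup>2 \<le> (norm (a - z))\<^sup>2 - (norm (closest_point K a - a))\<^sup>2"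
  using closest_point_dot [OF assms, of a]
  by (simp add: power2_norm_eq_inner inner_simps inner_commute algebra_simps)

text \<open>The first-order effect of the perturbation is evaluated at \<open>r\<close> instead of \<open>q\<close>, the point
  where it happens.  Half of the gain from the two moves pays for this exchange, by Young's inequality.\<close>

lemma perturbed_step_towards:
  fixes w :: "real ^ 'n"
  assumes K: "convex K" "closed K" "z \<in> K" and s: "s \<in> subdifferential h r" and z: "h z \<le> 1"
    and "0 \<le> m"
  defines "a \<equiv> subgradient_step h r s"
  defines "q \<equiv> closest_point K a"
  shows "(norm (q + m *\<^sub>R w - z))\<^sup>2 \<le> (norm (r - z))\<^sup>2
    - ((norm (a - r))\<^sup>2 + (norm (q - a))\<^sup>2) / 2 + 2 * m * (w \<bullet> r - w \<bullet> z) + 5 * (m * norm w)\<^sup>2"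
proof -
  have 1: "(norm (q - z))\<^sup>2 \<le> (norm (r - z))\<^sup>2 - (norm (a - r))\<^sup>2 - (norm (q - a))\<^sup>2"
    using closest_point_towards [OF K, of a] subgradient_step_towards [OF s z]
    unfolding a_def q_def by linarith
  have young: "2 * m * (w \<bullet> v) \<le> (norm v)\<^sup>2 / 2 + 2 * (m * norm w)\<^sup>2" for v
  proof -
    have "2 * m * (w \<bullet> v) \<le> 2 * m * (norm w * norm v)"
      using \<open>0 \<le> m\<close> norm_cauchy_schwarz [of w v] by (intro mult_left_mono) auto
    moreover have "0 \<le> (norm v - 2 * (m * norm w))\<^sup>2" by simp
    ultimately show ?thesis by (simp add: power2_diff algebra_simps power2_eq_square)
  qed
  have "(norm (q + m *\<^sub>R w - z))\<^sup>2
      = (norm (q - z))\<^sup>2 + 2 * m * (w \<bullet> r - w \<bullet> z) + 2 * m * (w \<bullet> (a - r)) + 2 * m * (w \<bullet> (q - a))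
        + (m * norm w)\<^sup>2"
    unfolding power_mult_distrib power2_norm_eq_inner
    by (simp add: inner_simps inner_commute algebra_simps power2_eq_square)
  then show ?thesis using 1 young [of "a - r"] young [of "q - a"] by argo
qed

text \<open>A lower bound for the gain in terms of \<open>r\<close> alone, continuous in \<open>r\<close> and positive exactly at
  infeasible points: this makes a compactness argument possible although the moves themselves depend
  on the choice of the subgradient.\<close>

lemma subgradient_step_gap:
  assumes s: "s \<in> subdifferential h r" and z: "h z \<le> 1" and L: "norm s \<le> L" "0 < L" and K: "closed K" "K \<noteq> {}"
  defines "a \<equiv> subgradient_step h r s"
  defines "q \<equiv> closest_point K a"
  shows "(max 0 (h r - 1) / L + infdist r K)\<^sup>2 \<le> 8 * ((norm (a - r))\<^sup>2 + (norm (q - a))\<^sup>2)"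
proof -
  have "max 0 (h r - 1) / L \<le> norm (a - r)"
  proof (cases "1 < h r")
    case True
    have "(z - r) \<bullet> s + h r \<le> h z" using s by (simp add: subdifferential_def)
    with True z have "s \<noteq> 0" by auto
    then have "norm (a - r) = (h r - 1) / norm s"
      using True by (simp add: a_def subgradient_step_def power2_eq_square)
    then show ?thesis using True L \<open>s \<noteq> 0\<close> by (simp add: frac_le)
  qed simp
  moreover have "infdist r K \<le> norm (a - r) + norm (q - a)"
  proof -
    have "q \<in> K" using K by (simp add: q_def closest_point_in_set)
    then have "infdist r K \<le> dist r q" by (rule infdist_le)
    also have "\<dots> \<le> dist r a + dist a q" by (rule dist_triangle)
    finally show ?thesis by (simp add: dist_norm norm_minus_commute)
  qed
  ultimately have "max 0 (h r - 1) / L + infdist r K \<le> 2 * norm (a - r) + norm (q - a)" by linarith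
  moreover have "0 \<le> max 0 (h r - 1) / L + infdist r K" using L infdist_nonneg [of r K] by simp
  ultimately have "(max 0 (h r - 1) / L + infdist r K)\<^sup>2 \<le> (2 * norm (a - r) + norm (q - a))\<^sup>2"
    by (rule power_mono)
  also have "\<dots> \<le> 8 * ((norm (a - r))\<^sup>2 + (norm (q - a))\<^sup>2)"
  proof -
    have "(2 * x + y)\<^sup>2 + (2 * x - y)\<^sup>2 + 6 * y\<^sup>2 = 8 * (x\<^sup>2 + y\<^sup>2)" for x y :: real
      by (simp add: power2_eq_square algebra_simps)
    from this [of "norm (a - r)" "norm (q - a)"] show ?thesis
      using zero_le_power2 [of "2 * norm (a - r) - norm (q - a)"] zero_le_power2 [of "norm (q - a)"] by linarith
  qed
  finally show ?thesis .
qed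

text \<open>Testing the subgradient inequality at unit distance from \<open>r\<close> in the direction of \<open>s\<close> bounds
  \<open>norm s\<close> by the oscillation of \<open>h\<close> on a slightly larger ball.\<close>

lemma subgradients_bounded:
  fixes h :: "real ^ 'n \<Rightarrow> real"
  assumes "continuous_on UNIV h"
  obtains L where "0 < L" "\<And>r s. norm r \<le> R \<Longrightarrow> s \<in> subdifferential h r \<Longrightarrow> norm s \<le> L"
proof -
  have "bounded (h ` cball 0 (R + 1))"
    by (intro compact_imp_bounded compact_continuous_image continuous_on_subset [OF assms]) auto
  then obtain M where M: "0 < M" "\<And>x. norm x \<le> R + 1 \<Longrightarrow> \<bar>h x\<bar> \<le> M"
    by (auto simp: bounded_pos)
  have "norm s \<le> 2 * M" if r: "norm r \<le> R" and s: "s \<in> subdifferential h r" for r s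
  proof -
    define y where "y = r + sgn s"
    have "norm y \<le> R + 1"
      using r norm_triangle_ineq [of r "sgn s"] by (simp add: y_def norm_sgn split: if_splits)
    moreover have "(y - r) \<bullet> s + h r \<le> h y" using s by (simp add: subdifferential_def)
    moreover have "(y - r) \<bullet> s = norm s"
      by (cases "s = 0") (simp_all add: y_def sgn_div_norm dot_square_norm power2_eq_square)
    ultimately show ?thesis using M(2) [of y] M(2) [of r] r by auto
  qed
  with M(1) show ?thesis by (intro that [of "2 * M"]) auto
qed

text \<open>The Lyapunov function is the distance \<open>d\<close> to \<open>\<Omega>\<close>.  On the compact set of points at distance at
  least \<open>\<epsilon>\<close> from \<open>\<Omega>\<close>, the maximum of the infeasibility \<open>\<theta>\<close> and the objective gap \<open>v - w \<bullet> x\<close> is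
  continuous and positive, because a feasible point without gap belongs to \<open>\<Omega>\<close>.  Its minimum
  \<open>\<eta>\<close> yields the rate of decrease in both cases.\<close>

lemma perturbed_subgradient_projection_converges:
  fixes h :: "real ^ 'n \<Rightarrow> real" and w :: "real ^ 'n"
  assumes h: "continuous_on UNIV h" and K: "compact K" "convex K"
    and feasible: "K \<inter> lev_le_one h \<noteq> {}"
    and \<mu>: "admissible_steps \<mu>"
    and s: "\<And>k. 1 \<le> k \<Longrightarrow> s k \<in> subdifferential h (r k)"
    and r: "\<And>k. 1 \<le> k \<Longrightarrow> r (Suc k) = closest_point K (subgradient_step h (r k) (s k)) + \<mu> k *\<^sub>R w"
  defines "\<Omega> \<equiv> {z. is_arg_min (Psi w) (\<lambda>r. r \<in> K \<inter> lev_le_one h) z}"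
  shows "dist_tends_to_zero r \<Omega>"
proof -
  define C where "C = K \<inter> lev_le_one h"
  have "closed (lev_le_one h)"
    unfolding lev_le_one_def by (intro closed_Collect_le h continuous_intros)
  with K feasible have C: "compact C" "C \<noteq> {}" "C \<subseteq> K"
    by (auto simp: C_def compact_Int_closed)
  have "\<exists>x \<in> C. \<forall>y \<in> C. w \<bullet> y \<le> w \<bullet> x"
    by (intro continuous_attains_sup C continuous_intros)
  then obtain z0 where z0: "z0 \<in> C" "\<And>y. y \<in> C \<Longrightarrow> w \<bullet> y \<le> w \<bullet> z0" by blast
  define v where "v = w \<bullet> z0"
  have \<Omega>: "\<Omega> = C \<inter> {z. w \<bullet> z = v}"
    using z0 by (force simp: \<Omega>_def is_arg_min_linorder Psi_def v_def C_def)
  have v: "w \<bullet> z \<le> v" if "z \<in> C" for z using z0 that by (simp add: v_def)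
  have \<Omega>_closed: "closed \<Omega>"
    unfolding \<Omega> by (intro closed_Int compact_imp_closed [OF C(1)] closed_Collect_eq continuous_intros)
  have \<Omega>_ne: "\<Omega> \<noteq> {}" using z0 \<Omega> by (auto simp: v_def)
  have K': "closed K" "K \<noteq> {}" using K C by (auto simp: compact_imp_closed)
  have \<mu>': "\<mu> \<longlonglongrightarrow> 0" "filterlim (\<lambda>m. \<Sum>k = 1..m. \<mu> k) at_top sequentially" "\<And>k. 1 \<le> k \<Longrightarrow> 0 < \<mu> k"
    using \<mu> by (auto simp: admissible_steps_def)
  obtain R where R: "\<And>k. 1 \<le> k \<Longrightarrow> norm (r k) \<le> R"
  proof -
    obtain A where A: "\<And>x. x \<in> K \<Longrightarrow> norm x \<le> A"
      using compact_imp_bounded [OF K(1)] by (auto simp: bounded_iff)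
    have "Bseq \<mu>" using \<mu>'(1) by (auto intro: convergent_imp_Bseq convergentI)
    then obtain B where B: "\<And>k. \<bar>\<mu> k\<bar> \<le> B" by (auto simp: Bseq_def)
    have "norm (r k) \<le> max (norm (r 1)) (A + B * norm w)" if "1 \<le> k" for k
    proof (cases "k = 1")
      case False
      with that obtain j where j: "k = Suc j" "1 \<le> j" by (cases k) auto
      have "norm (r k) \<le> norm (closest_point K (subgradient_step h (r j) (s j))) + norm (\<mu> j *\<^sub>R w)"
        unfolding j(1) r [OF j(2)] by (rule norm_triangle_ineq)
      also have "\<dots> \<le> A + B * norm w"
        using A [OF closest_point_in_set [OF K']] B [of j] by (intro add_mono) (auto intro: mult_right_mono)
      finally show ?thesis by simp
    qed simp
    then show ?thesis using that by blast
  qed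
  obtain L where L: "0 < L" "\<And>r s. norm r \<le> R \<Longrightarrow> s \<in> subdifferential h r \<Longrightarrow> norm s \<le> L"
    using subgradients_bounded [OF h] by blast
  define \<theta> where "\<theta> x = max 0 (h x - 1) / L + infdist x K" for x
  define \<Delta> where "\<Delta> k = (norm (subgradient_step h (r k) (s k) - r k))\<^sup>2
    + (norm (closest_point K (subgradient_step h (r k) (s k)) - subgradient_step h (r k) (s k)))\<^sup>2" for k
  have \<Delta>: "(\<theta> (r k))\<^sup>2 \<le> 8 * \<Delta> k" if "1 \<le> k" for k
    unfolding \<theta>_def \<Delta>_def
    by (rule subgradient_step_gap [OF s [OF that] _ L(2) [OF R [OF that] s [OF that]] L(1) K', of z0])
      (use z0 in \<open>simp add: C_def lev_le_one_def\<close>)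
  have \<Delta>0: "0 \<le> \<Delta> k" for k by (simp add: \<Delta>_def)
  define d where "d k = infdist (r k) \<Omega>" for k
  have step: "(d (Suc k))\<^sup>2 \<le> (d k)\<^sup>2 - \<Delta> k / 2 + 2 * \<mu> k * (w \<bullet> r k - v) + 5 * (\<mu> k * norm w)\<^sup>2"
    and small: "d (Suc k) \<le> d k + norm w * \<mu> k" if k: "1 \<le> k" for k
  proof -
    obtain z where z: "z \<in> \<Omega>" "d k = dist (r k) z"
      using infdist_attains_inf [OF \<Omega>_closed \<Omega>_ne] unfolding d_def by blast
    have zC: "z \<in> K" "h z \<le> 1" "w \<bullet> z = v" using z by (auto simp: \<Omega> C_def lev_le_one_def)
    have dz: "d (Suc k) \<le> norm (r (Suc k) - z)"
      unfolding d_def dist_norm [symmetric] by (rule infdist_le [OF z(1)])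
    then have "(d (Suc k))\<^sup>2 \<le> (norm (r (Suc k) - z))\<^sup>2"
      by (rule power_mono) (simp add: d_def infdist_nonneg)
    also have "\<dots> \<le> (norm (r k - z))\<^sup>2 - \<Delta> k / 2 + 2 * \<mu> k * (w \<bullet> r k - v) + 5 * (\<mu> k * norm w)\<^sup>2"
      using perturbed_step_towards [OF K(2) K'(1) zC(1) s [OF k] zC(2), of "\<mu> k" w] \<mu>'(3) [OF k]
      by (simp add: r [OF k] zC(3) \<Delta>_def)
    finally show "(d (Suc k))\<^sup>2 \<le> (d k)\<^sup>2 - \<Delta> k / 2 + 2 * \<mu> k * (w \<bullet> r k - v) + 5 * (\<mu> k * norm w)\<^sup>2"
      by (simp add: z(2) dist_norm)
    define q where "q = closest_point K (subgradient_step h (r k) (s k))"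
    have "(norm (q - z))\<^sup>2 \<le> (norm (r k - z))\<^sup>2"
      using closest_point_towards [OF K(2) K'(1) zC(1), of "subgradient_step h (r k) (s k)"]
        subgradient_step_towards [OF s [OF k] zC(2)]
        zero_le_power2 [of "norm (subgradient_step h (r k) (s k) - r k)"]
        zero_le_power2 [of "norm (q - subgradient_step h (r k) (s k))"]
      unfolding q_def by linarith
    then have "norm (q - z) \<le> norm (r k - z)" by (rule power2_le_imp_le) simp
    moreover have "norm (r (Suc k) - z) \<le> norm (q - z) + norm w * \<mu> k"
    proof -
      have "r (Suc k) - z = (q - z) + \<mu> k *\<^sub>R w" by (simp add: r [OF k] q_def)
      moreover have "norm (\<mu> k *\<^sub>R w) = norm w * \<mu> k" using \<mu>'(3) [OF k] by simp
      ultimately show ?thesis using norm_triangle_ineq [of "q - z" "\<mu> k *\<^sub>R w"] by metis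
    qed
    ultimately show "d (Suc k) \<le> d k + norm w * \<mu> k" using dz z(2) by (simp add: dist_norm)
  qed
  have "d \<longlonglongrightarrow> 0"
  proof (rule lyapunov_tendsto_zero [OF _ \<mu>'])
    show "0 \<le> d k" for k by (simp add: d_def infdist_nonneg)
    show "\<forall>\<^sub>F k in sequentially. d (Suc k) \<le> d k + norm w * \<mu> k"
      using small by (auto simp: eventually_sequentially)
    fix \<epsilon> :: real assume \<epsilon>: "0 < \<epsilon>"
    define S where "S = {x. norm x \<le> R \<and> \<epsilon> \<le> infdist x \<Omega>}"
    define f where "f x = max (\<theta> x) (v - w \<bullet> x)" for x
    have "S = cball 0 R \<inter> {x. \<epsilon> \<le> infdist x \<Omega>}" by (auto simp: S_def)
    then have S: "compact S"
      by (auto intro!: compact_Int_closed closed_Collect_le continuous_intros)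
    have contf: "continuous_on S f"
      unfolding f_def \<theta>_def using L(1)
      by (intro continuous_intros continuous_on_subset [OF h]) auto
    have pos: "0 < f x" if "x \<in> S" for x
    proof (rule ccontr)
      assume "\<not> 0 < f x"
      then have f: "\<theta> x \<le> 0" "v \<le> w \<bullet> x" by (auto simp: f_def)
      have "0 \<le> max 0 (h x - 1) / L" using L by simp
      then have "max 0 (h x - 1) / L = 0" "infdist x K = 0"
        using f(1) infdist_nonneg [of x K] unfolding \<theta>_def by linarith+
      then have "x \<in> C"
        using L(1) K' in_closed_iff_infdist_zero [OF K'] by (auto simp: C_def lev_le_one_def max_def split: if_splits)
      with f(2) v [of x] have "x \<in> \<Omega>" by (auto simp: \<Omega>)
      with that \<epsilon> show False by (simp add: S_def)
    qed
    obtain \<eta> where \<eta>: "0 < \<eta>" "\<And>x. x \<in> S \<Longrightarrow> \<eta> \<le> f x"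
    proof (cases "S = {}")
      case False
      then obtain x where "x \<in> S" "\<And>y. y \<in> S \<Longrightarrow> f x \<le> f y"
        using continuous_attains_inf [OF S _ contf] by blast
      then show ?thesis using that pos by blast
    qed (use that [of 1] in auto)
    define W where "W = norm w * R + \<bar>v\<bar>"
    have W: "w \<bullet> r k - v \<le> W" if "1 \<le> k" for k
    proof -
      have "w \<bullet> r k \<le> norm w * norm (r k)" by (rule norm_cauchy_schwarz)
      also have "\<dots> \<le> norm w * R" using R [OF that] by (intro mult_left_mono) auto
      finally show ?thesis by (simp add: W_def)
    qed
    \<comment> \<open>First threshold: the second-order term is at most half of the first-order gain \<open>2 \<mu> \<eta>\<close>.
      Second threshold: a gain \<open>\<Delta> / 2 \<ge> \<eta>\<^sup>2 / 16\<close> outweighs all terms of order \<open>\<mu>\<close>.\<close>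
    have "(\<lambda>k. \<mu> k * (5 * (norm w)\<^sup>2)) \<longlonglongrightarrow> 0" by (rule tendsto_mult_left_zero [OF \<mu>'(1)])
    then have e1: "\<forall>\<^sub>F k in sequentially. \<mu> k * (5 * (norm w)\<^sup>2) < \<eta>"
      using \<eta>(1) by (rule order_tendstoD(2))
    have "(\<lambda>k. \<mu> k * (2 * W + 2 * \<eta>)) \<longlonglongrightarrow> 0" by (rule tendsto_mult_left_zero [OF \<mu>'(1)])
    then have e2: "\<forall>\<^sub>F k in sequentially. \<mu> k * (2 * W + 2 * \<eta>) < \<eta>\<^sup>2 / 16"
      by (rule order_tendstoD(2)) (use \<eta>(1) in simp)
    have "\<forall>\<^sub>F k in sequentially. \<epsilon> \<le> d k \<longrightarrow> (d (Suc k))\<^sup>2 \<le> (d k)\<^sup>2 - \<eta> * \<mu> k"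
      using e1 e2 eventually_ge_at_top [of 1]
    proof (eventually_elim, intro impI)
      fix k
      assume k: "\<mu> k * (5 * (norm w)\<^sup>2) < \<eta>" "\<mu> k * (2 * W + 2 * \<eta>) < \<eta>\<^sup>2 / 16" "1 \<le> k" "\<epsilon> \<le> d k"
      have "r k \<in> S" using k(4) R [OF k(3)] by (simp add: S_def d_def)
      then have "\<eta> \<le> \<theta> (r k) \<or> \<eta> \<le> v - w \<bullet> r k" using \<eta>(2) by (fastforce simp: f_def le_max_iff_disj)
      moreover have m: "0 < \<mu> k" using \<mu>'(3) k(3) by simp
      have "\<mu> k * (\<mu> k * (5 * (norm w)\<^sup>2)) \<le> \<mu> k * \<eta>" using k(1) m by (intro mult_left_mono) auto
      then have q: "5 * (\<mu> k * norm w)\<^sup>2 \<le> \<mu> k * \<eta>" by (simp add: power_mult_distrib power2_eq_square mult_ac)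
      have "\<mu> k * (w \<bullet> r k - v) \<le> \<mu> k * W" using W [OF k(3)] m by (intro mult_left_mono) auto
      moreover have "\<mu> k * (w \<bullet> r k - v) \<le> \<mu> k * (- \<eta>)" if "\<eta> \<le> v - w \<bullet> r k"
        using that m by (intro mult_left_mono) auto
      moreover have "\<eta>\<^sup>2 \<le> 8 * \<Delta> k" if "\<eta> \<le> \<theta> (r k)"
        using power_mono [OF that, of 2] \<eta>(1) \<Delta> [OF k(3)] by simp
      ultimately show "(d (Suc k))\<^sup>2 \<le> (d k)\<^sup>2 - \<eta> * \<mu> k"
        using step [OF k(3)] q k(2) \<Delta>0 [of k] by (auto simp: algebra_simps)
    qed
    with \<eta>(1) show "\<exists>\<eta> > 0. \<forall>\<^sub>F k in sequentially. \<epsilon> \<le> d k \<longrightarrow> (d (Suc k))\<^sup>2 \<le> (d k)\<^sup>2 - \<eta> * \<mu> k"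
      by blast
  qed
  then show ?thesis using \<Omega>_closed \<Omega>_ne by (simp add: dist_tends_to_zero_def d_def [abs_def])
qed

section \<open>Application to the rate region\<close>

text \<open>All three properties pass from the functions \<open>g + u \<nu>\<close> to their infimum; strict positivity
  survives because \<open>u\<close> has a positive lower bound.\<close>

lemma perron_mapping_norm_mapping:
  assumes compat: "compatible F \<nu> Y g u"
    and G: "\<forall>x \<in> nonneg_orthant. G x = norm_mapping \<nu> Y g u x"
  shows "perron_mapping G"
proof
  have \<nu>: "0 \<le> \<nu> x" "\<nu> x = 0 \<longleftrightarrow> x = 0" "\<nu> (a *\<^sub>R x) = \<bar>a\<bar> * \<nu> x"
    and \<nu>_mono: "0 \<le> x \<Longrightarrow> x \<le> y \<Longrightarrow> \<nu> x \<le> \<nu> y" for a x y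
    using compat by (auto simp: compatible_def order_preserving_norm_def is_norm_def)
  have Y: "Y n \<noteq> {}" for n using compat by (auto simp: compatible_def)
  have phoc: "phoc (g n y)" if "y \<in> Y n" for n y using compat that by (auto simp: compatible_def)
  have u: "\<exists>\<delta> > 0. \<forall>y \<in> Y n. \<delta> \<le> u n y" for n using compat by (auto simp: compatible_def)
  have u0: "0 < u n y" if "y \<in> Y n" for n y using u [of n] that by force
  have Gn: "G x $ n = (INF y \<in> Y n. g n y x + u n y * \<nu> x)" if "x \<in> nonneg_orthant" for x n
    using G that by (simp add: norm_mapping_def)
  have g0: "0 \<le> g n y x" if "y \<in> Y n" "x \<in> nonneg_orthant" for n y x
    using phoc [OF that(1)] that(2) by (simp add: phoc_def)
  show "continuous_on nonneg_orthant G"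
  proof -
    have "continuous_on nonneg_orthant (\<lambda>x. \<chi> n. norm_mapping \<nu> Y g u x $ n)"
      using compat by (intro continuous_on_vec_lambda) (simp add: compatible_def)
    then show ?thesis using G by (simp cong: continuous_on_cong)
  qed
  show "0 < G p $ n" if p: "p \<in> nonneg_orthant" "p \<noteq> 0" for p n
  proof -
    obtain \<delta> where \<delta>: "0 < \<delta>" "\<And>y. y \<in> Y n \<Longrightarrow> \<delta> \<le> u n y" using u [of n] by blast
    have "\<delta> * \<nu> p \<le> G p $ n"
      unfolding Gn [OF p(1)]
    proof (rule cINF_greatest [OF Y])
      fix y assume y: "y \<in> Y n"
      have "\<delta> * \<nu> p \<le> u n y * \<nu> p" using \<delta>(2) [OF y] \<nu>(1) by (rule mult_right_mono)
      with g0 [OF y p(1)] show "\<delta> * \<nu> p \<le> g n y p + u n y * \<nu> p" by simp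
    qed
    moreover have "0 < \<nu> p" using \<nu>(1,2) [of p] p(2) by (simp add: less_le)
    ultimately show ?thesis using \<delta>(1) mult_pos_pos [of \<delta> "\<nu> p"] by linarith
  qed
  show "G p $ n \<le> t * G q $ n"
    if p: "p \<in> nonneg_orthant" and q: "q \<in> nonneg_orthant" and t: "0 < t" and le: "p \<le> t *\<^sub>R q" for p q t n
  proof -
    have tq: "t *\<^sub>R q \<in> nonneg_orthant" using q t by (simp add: nonneg_orthant_iff)
    have "G p $ n / t \<le> (INF y \<in> Y n. g n y q + u n y * \<nu> q)"
    proof (rule cINF_greatest [OF Y])
      fix y assume y: "y \<in> Y n"
      have "bdd_below ((\<lambda>y. g n y p + u n y * \<nu> p) ` Y n)"
        by (rule bdd_belowI2 [of _ 0]) (use g0 [OF _ p] u0 \<nu>(1) in \<open>simp add: less_imp_le\<close>)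
      then have "G p $ n \<le> g n y p + u n y * \<nu> p"
        unfolding Gn [OF p] using y by (rule cINF_lower)
      also have "g n y p \<le> g n y (t *\<^sub>R q)"
        using phoc [OF y] p tq le by (simp add: phoc_def)
      also have "\<dots> = t * g n y q" using phoc [OF y] q t by (simp add: phoc_def)
      also have "\<nu> p \<le> \<nu> (t *\<^sub>R q)"
        using \<nu>_mono p le by (simp add: nonneg_orthant_def)
      also have "\<dots> = t * \<nu> q" using \<nu>(3) t by simp
      finally have "G p $ n \<le> t * (g n y q + u n y * \<nu> q)"
        using u0 [OF y] by (simp add: algebra_simps)
      then show "G p $ n / t \<le> g n y q + u n y * \<nu> q"
        using t by (simp add: pos_divide_le_eq mult.commute)
    qed
    then show ?thesis using t by (simp add: Gn [OF q] pos_divide_le_eq mult.commute)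
  qed
qed

lemma box_zero_iff: "r \<in> box_zero b \<longleftrightarrow> (\<forall>i. 0 \<le> r $ i \<and> r $ i \<le> b)"
  by (simp add: box_zero_def mem_box_cart)

lemma generated_from_step:
  assumes "generated_from G w b \<mu> r1 r"
  obtains s where "r 1 = r1" "\<And>k. 1 \<le> k \<Longrightarrow> s k \<in> subdifferential (h_fun G) (r k)"
    "\<And>k. 1 \<le> k \<Longrightarrow> r (Suc k) = closest_point (box_zero b) (subgradient_step (h_fun G) (r k) (s k)) + \<mu> k *\<^sub>R w"
  using assms unfolding generated_from_def Let_def gradient_Psi by auto

lemma generated_from_pos:
  assumes r: "generated_from G w b \<mu> r1 r" and "r1 \<in> pos_orthant" "w \<in> pos_orthant" "0 \<le> b"
    and \<mu>: "admissible_steps \<mu>" and "1 \<le> k"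
  shows "r k \<in> pos_orthant"
proof -
  obtain s where s: "r 1 = r1"
    "\<And>k. 1 \<le> k \<Longrightarrow> r (Suc k) = closest_point (box_zero b) (subgradient_step (h_fun G) (r k) (s k)) + \<mu> k *\<^sub>R w"
    using generated_from_step [OF r] by blast
  show ?thesis
  proof (cases "k = 1")
    case False
    with \<open>1 \<le> k\<close> obtain j where j: "k = Suc j" "1 \<le> j" by (cases k) auto
    define q where "q = closest_point (box_zero b) (subgradient_step (h_fun G) (r j) (s j))"
    have "0 \<in> box_zero b" using \<open>0 \<le> b\<close> by (simp add: box_zero_iff)
    then have "q \<in> box_zero b"
      unfolding q_def by (intro closest_point_in_set) (auto simp: box_zero_def)
    moreover have "0 < \<mu> j" using \<mu> j by (simp add: admissible_steps_def)
    moreover have "r k = q + \<mu> j *\<^sub>R w" using s(2) [OF j(2)] by (simp add: j(1) q_def)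
    ultimately show ?thesis
      using \<open>w \<in> pos_orthant\<close> by (simp add: pos_orthant_def box_zero_iff add_nonneg_pos)
  qed (use s assms in simp)
qed

lemma dist_tends_to_zero_superset:
  assumes "dist_tends_to_zero r A" "A \<subseteq> B" "closed B"
  shows "dist_tends_to_zero r B"
proof -
  have A: "A \<noteq> {}" "(\<lambda>k. infdist (r k) A) \<longlonglongrightarrow> 0"
    using assms by (auto simp: dist_tends_to_zero_def)
  have "(\<lambda>k. infdist (r k) B) \<longlonglongrightarrow> 0"
  proof (rule tendsto_sandwich [OF _ _ tendsto_const A(2)])
    show "\<forall>\<^sub>F k in sequentially. infdist (r k) B \<le> infdist (r k) A"
      using infdist_mono [OF assms(2) A(1)] by (intro always_eventually allI)
  qed (simp add: infdist_nonneg)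
  with assms A show ?thesis by (auto simp: dist_tends_to_zero_def)
qed

lemma inner_tendsto_of_dist_tends_to_zero:
  assumes r: "dist_tends_to_zero r A" and A: "\<And>z. z \<in> A \<Longrightarrow> w \<bullet> z = v"
  shows "(\<lambda>k. w \<bullet> r k) \<longlonglongrightarrow> v"
proof -
  have bound: "\<bar>w \<bullet> r k - v\<bar> \<le> norm w * infdist (r k) A" for k
  proof -
    obtain z where z: "z \<in> A" "infdist (r k) A = dist (r k) z"
      using infdist_attains_inf [of A "r k"] r by (auto simp: dist_tends_to_zero_def)
    have "w \<bullet> r k - v = w \<bullet> (r k - z)" using A [OF z(1)] by (simp add: inner_diff_right)
    then show ?thesis
      using Cauchy_Schwarz_ineq2 [of w "r k - z"] z(2) by (simp add: dist_norm)
  qed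
  have "(\<lambda>k. norm w * infdist (r k) A) \<longlonglongrightarrow> 0"
    using r by (intro tendsto_mult_right_zero) (simp add: dist_tends_to_zero_def)
  then have "(\<lambda>k. w \<bullet> r k - v) \<longlonglongrightarrow> 0"
    by (rule Lim_null_comparison [rotated]) (use bound in simp)
  then show ?thesis by (rule LIM_zero_cancel)
qed

theorem mainTheorem1:
  fixes G F :: "real ^ 'n \<Rightarrow> real ^ 'n"
    and \<nu> :: "real ^ 'n \<Rightarrow> real"
    and Y :: "'n \<Rightarrow> 'y set"
    and g :: "'n \<Rightarrow> 'y \<Rightarrow> real ^ 'n \<Rightarrow> real"
    and u :: "'n \<Rightarrow> 'y \<Rightarrow> real"
    and w :: "real ^ 'n"
  assumes "compatible F \<nu> Y g u"
    and "\<forall>x \<in> nonneg_orthant. G x = norm_mapping \<nu> Y g u x"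
    and "convex_on pos_orthant (\<lambda>r. spectral_fun G (exp_minus_one r))"
    and "w \<in> pos_orthant"
  shows "(\<forall>b > 0. \<forall>r1 \<in> pos_orthant. \<forall>\<mu> r.
            admissible_steps \<mu> \<longrightarrow> generated_from G w b \<mu> r1 r \<longrightarrow>
              dist_tends_to_zero r (solution_set G w b) \<and>
              (\<forall>k \<ge> 1. r k \<in> pos_orthant) \<and>
              dist_tends_to_zero r (rate_region G)) \<and>
         (\<exists>c > 0. \<forall>b \<ge> c. \<forall>r1 \<in> pos_orthant. \<forall>\<mu> r.
            admissible_steps \<mu> \<longrightarrow> generated_from G w b \<mu> r1 r \<longrightarrow>
              (\<exists>rmax. is_arg_max (\<lambda>r. w \<bullet> r) (\<lambda>r. r \<in> rate_region G) rmax \<and>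
                 (\<lambda>k. w \<bullet> r k) \<longlonglongrightarrow> w \<bullet> rmax))"
proof -
  interpret perron_mapping G
    using assms(1,2) by (rule perron_mapping_norm_mapping)
  have box: "compact (box_zero b :: (real ^ 'n) set)" "convex (box_zero b :: (real ^ 'n) set)" for b
    by (simp_all add: box_zero_def)
  have conv: "dist_tends_to_zero r (solution_set G w b)"
    if b: "0 < b" and \<mu>: "admissible_steps \<mu>" and r: "generated_from G w b \<mu> r1 r" for b \<mu> r1 r
  proof -
    obtain s where s: "\<And>k. 1 \<le> k \<Longrightarrow> s k \<in> subdifferential (h_fun G) (r k)"
      "\<And>k. 1 \<le> k \<Longrightarrow> r (Suc k) = closest_point (box_zero b) (subgradient_step (h_fun G) (r k) (s k)) + \<mu> k *\<^sub>R w"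
      using generated_from_step [OF r] by blast
    have "0 \<in> box_zero b \<inter> lev_le_one (h_fun G)"
      using zero_in_lev b by (simp add: box_zero_iff)
    then have "box_zero b \<inter> lev_le_one (h_fun G) \<noteq> {}" by blast
    from perturbed_subgradient_projection_converges [OF continuous_on_h_fun box this \<mu> s]
    show ?thesis by (simp add: solution_set_def)
  qed
  have box_rate: "box_zero b \<inter> lev_le_one (h_fun G) \<subseteq> rate_region G" for b
    by (auto simp: rate_region_eq box_zero_iff nonneg_orthant_iff)
  have sub: "solution_set G w b \<subseteq> rate_region G" for b
    using box_rate [of b] by (auto simp: solution_set_def is_arg_min_def)
  have closed: "closed (rate_region G)"
    unfolding rate_region_eq by (intro closed_Int closed_nonneg_orthant closed_lev_h_fun)
  \<comment> \<open>Any bound for the coordinates on the rate region serves; adding \<open>1\<close> makes it positive.\<close>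
  define c where "c = 1 + (\<Sum>i\<in>UNIV. \<bar>1 / G (axis i 1) $ i\<bar>)"
  have "0 < c" unfolding c_def by (intro add_pos_nonneg sum_nonneg) auto
  have rate_box: "rate_region G \<subseteq> box_zero b" if "c \<le> b" for b
  proof
    fix r assume r: "r \<in> rate_region G"
    have "r $ i \<le> b" for i
    proof -
      have "\<bar>1 / G (axis i 1) $ i\<bar> \<le> (\<Sum>i\<in>UNIV. \<bar>1 / G (axis i 1) $ i\<bar>)"
        by (rule member_le_sum [of i UNIV "\<lambda>i. \<bar>1 / G (axis i 1) $ i\<bar>"]) auto
      with rate_region_le [OF r, of i] that show ?thesis unfolding c_def by linarith
    qed
    with r show "r \<in> box_zero b" by (simp add: box_zero_iff rate_region_eq nonneg_orthant_iff)
  qed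
  have max: "\<exists>rmax. is_arg_max (\<lambda>r. w \<bullet> r) (\<lambda>r. r \<in> rate_region G) rmax \<and>
      (\<lambda>k. w \<bullet> r k) \<longlonglongrightarrow> w \<bullet> rmax"
    if b: "c \<le> b" and \<mu>: "admissible_steps \<mu>" and r: "generated_from G w b \<mu> r1 r" for b r1 \<mu> r
  proof -
    have "box_zero b \<inter> lev_le_one (h_fun G) = rate_region G"
      using box_rate [of b] rate_box [OF b] by (auto simp: rate_region_eq)
    then have sol: "z \<in> solution_set G w b \<longleftrightarrow> is_arg_max (\<lambda>r. w \<bullet> r) (\<lambda>r. r \<in> rate_region G) z" for z
      by (simp add: solution_set_def is_arg_min_def is_arg_max_def Psi_def)
    have d: "dist_tends_to_zero r (solution_set G w b)"
      using conv \<open>0 < c\<close> b \<mu> r by simp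
    then obtain z where z: "z \<in> solution_set G w b" by (auto simp: dist_tends_to_zero_def)
    have "w \<bullet> y = w \<bullet> z" if "y \<in> solution_set G w b" for y
      using that z unfolding sol is_arg_max_linorder by (meson order_antisym)
    from inner_tendsto_of_dist_tends_to_zero [OF d this] z show ?thesis
      unfolding sol by blast
  qed
  show ?thesis
  proof (intro conjI allI ballI impI exI [of _ c])
    fix b :: real and r1 and \<mu> r and k :: nat
    assume *: "0 < b" "r1 \<in> pos_orthant" "admissible_steps \<mu>" "generated_from G w b \<mu> r1 r"
    show "dist_tends_to_zero r (solution_set G w b)" by (rule conv [OF *(1,3,4)])
    then show "dist_tends_to_zero r (rate_region G)" by (rule dist_tends_to_zero_superset [OF _ sub closed])
    show "r k \<in> pos_orthant" if "1 \<le> k"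
      using generated_from_pos [OF *(4,2) assms(4) less_imp_le [OF *(1)] *(3) that] .
  qed (use \<open>0 < c\<close> max in blast)+
qed

end
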